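(* Let $(W,S)$ be a Coxeter system, $Q=(\sigma_1,\ldots,\sigma_n)$ a word of size $n$ in $S$, $\pi\in W$, and let $\Delta=\Delta(Q,\pi)$ be the subword complex. Let $k$ be a field. Assume that $G(I_{\Delta^{\vee}})=\{\mathbf{x}_{P_1},\ldots,\mathbf{x}_{P_r}\}\subset k[x_1,\ldots,x_n]$ with $\mathbf{x}_{P_1}>_{lex}\cdots>_{lex}\mathbf{x}_{P_r}$, $r\le n-\ell(\pi)+1$ and $d_r=r-1$. Then the Stanley--Reisner ring $k[\Delta]$ is a complete intersection ring.
   Context: A word $Q=(\sigma_1,\ldots,\sigma_n)$ of size $n$ is an ordered sequence of elements of the set $S$ of simple reflections. A subword $P$ of $Q$ is an ordered subsequence, identified with its set of positions in $[n]=\{1,\ldots,n\}$. $P$ represents $\pi$ if the ordered product of the simple reflections in $P$ is a reduced expression for $\pi$; $P$ contains $\pi$ if some subsequence of $P$ represents $\pi$. The subword complex $\Delta(Q,\pi)$ is the simplicial complex (on the $n$ positions of $Q$) of all subwords $Q\setminus P$ such that $P$ contains $\pi$. $\ell$ is the length function of $(W,S)$. For a subword $P=(\sigma_{i_1},\ldots,\sigma_{i_m})$ of $Q$ put $\mathbf{x}_P=x_{i_1}\cdots x_{i_m}$. The Stanley--Reisner ideal of the Alexander dual of $\Delta=\Delta(Q,\pi)$ is $I_{\Delta^\vee}=(\mathbf{x}_P\mid P\subseteq Q,\ P\text{ represents }\pi)$. $G(I)$ denotes the minimal monomial generating set of a monomial ideal $I$, and $>_{lex}$ is the lexicographical order with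 $x_1>\cdots>x_n$. The ideal $I_{\Delta^\vee}$ has linear quotients with respect to $\mathbf{x}_{P_1},\ldots,\mathbf{x}_{P_r}$. Define $\mathrm{set}(\mathbf{x}_{P_i})=\{s\in[n] : x_s\in(\mathbf{x}_{P_1},\ldots,\mathbf{x}_{P_{i-1}}):\mathbf{x}_{P_i}\}$ for $2\le i\le r$, $\mathrm{set}(\mathbf{x}_{P_1})=\emptyset$, and $d_i=|\mathrm{set}(\mathbf{x}_{P_i})|$. $k[\Delta]=k[x_1,\ldots,x_n]/I_\Delta$, where $I_\Delta$ is the Stanley--Reisner ideal of $\Delta$; it is a complete intersection ring if $I_\Delta$ is generated by a regular sequence. *)

theory Defs
  imports
    "HOL-Algebra.Generated_Groups"
    "HOL-Algebra.Ideal"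
    "HOL-Library.Extended_Nat"
    "HOL-Library.Poly_Mapping"
begin

section \<open>Coxeter systems\<close>

text \<open>
  A word over \<open>S\<close> and formal inverses of elements of \<open>S\<close>: the letter \<open>(s, True)\<close> stands for
  \<open>s\<close> and \<open>(s, False)\<close> for the inverse of \<open>s\<close>.
\<close>

type_synonym 'w gword = "('w \<times> bool) list"

definition gword_eval :: "('w, 'b) monoid_scheme \<Rightarrow> 'w gword \<Rightarrow> 'w" where
  "gword_eval W u =
     foldr (\<lambda>(s, b) w. (if b then s else inv\<^bsub>W\<^esub> s) \<otimes>\<^bsub>W\<^esub> w) u \<one>\<^bsub>W\<^esub>"

text \<open>
  Equality of words in the group with generators \<open>S\<close> and relators \<open>R\<close>, that is, in the
  quotient of the free group on \<open>S\<close> by the normal closure of \<open>R\<close>.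
\<close>

inductive relator_cong :: "'w set \<Rightarrow> 'w gword set \<Rightarrow> 'w gword \<Rightarrow> 'w gword \<Rightarrow> bool"
  for S :: "'w set" and R :: "'w gword set" where
  refl: "relator_cong S R u u"
| sym: "relator_cong S R u v \<Longrightarrow> relator_cong S R v u"
| trans: "relator_cong S R u v \<Longrightarrow> relator_cong S R v w \<Longrightarrow> relator_cong S R u w"
| cancel: "s \<in> S \<Longrightarrow> relator_cong S R (u @ [(s, b), (s, \<not> b)] @ v) (u @ v)"
| relator: "\<rho> \<in> R \<Longrightarrow> relator_cong S R (u @ \<rho> @ v) (u @ v)"

text \<open>\<open>W\<close> has the presentation with generators \<open>S\<close> and relators \<open>R\<close>.\<close>

definition presented_by :: "('w, 'b) monoid_scheme \<Rightarrow> 'w set \<Rightarrow> 'w gword set \<Rightarrow> bool" where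
  "presented_by W S R \<longleftrightarrow>
     group W \<and> S \<subseteq> carrier W \<and> generate W S = carrier W \<and>
     (\<forall>u \<in> lists (S \<times> UNIV). \<forall>v \<in> lists (S \<times> UNIV).
        gword_eval W u = gword_eval W v \<longleftrightarrow> relator_cong S R u v)"

definition coxeter_matrix :: "'w set \<Rightarrow> ('w \<Rightarrow> 'w \<Rightarrow> enat) \<Rightarrow> bool" where
  "coxeter_matrix S m \<longleftrightarrow>
     (\<forall>s \<in> S. \<forall>t \<in> S. m s t = m t s \<and> 1 \<le> m s t \<and> (m s t = 1 \<longleftrightarrow> s = t))"

text \<open>The relators \<open>(s t)\<^bsup>m(s,t)\<^esup>\<close>; there is none for a pair with \<open>m(s,t) = \<infinity>\<close>.\<close>

definition coxeter_relators :: "'w set \<Rightarrow> ('w \<Rightarrow> 'w \<Rightarrow> enat) \<Rightarrow> 'w gword set" where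
  "coxeter_relators S m =
     {concat (replicate k [(s, True), (t, True)]) | s t k. s \<in> S \<and> t \<in> S \<and> m s t = enat k}"

definition coxeter_system :: "('w, 'b) monoid_scheme \<Rightarrow> 'w set \<Rightarrow> bool" where
  "coxeter_system W S \<longleftrightarrow> (\<exists>m. coxeter_matrix S m \<and> presented_by W S (coxeter_relators S m))"

definition word_prod :: "('w, 'b) monoid_scheme \<Rightarrow> 'w list \<Rightarrow> 'w" where
  "word_prod W ws = foldr (\<lambda>s w. s \<otimes>\<^bsub>W\<^esub> w) ws \<one>\<^bsub>W\<^esub>"

text \<open>
  In a Coxeter system the generators are involutions, so words in \<open>S\<close> without inverses
  suffice for the length function.
\<close>

definition cox_length :: "('w, 'b) monoid_scheme \<Rightarrow> 'w set \<Rightarrow> 'w \<Rightarrow> nat" where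
  "cox_length W S w = (LEAST k. \<exists>ws \<in> lists S. length ws = k \<and> word_prod W ws = w)"

definition reduced_expression :: "('w, 'b) monoid_scheme \<Rightarrow> 'w set \<Rightarrow> 'w list \<Rightarrow> 'w \<Rightarrow> bool" where
  "reduced_expression W S ws w \<longleftrightarrow>
     ws \<in> lists S \<and> word_prod W ws = w \<and> length ws = cox_length W S w"


section \<open>Subword complexes\<close>

text \<open>
  Positions are numbered from 1, so a subword of \<open>Q\<close> is a subset of \<open>{1..length Q}\<close>; the
  letter at position \<open>i\<close> is \<open>Q ! (i - 1)\<close>.
\<close>

definition subword_letters :: "'w list \<Rightarrow> nat set \<Rightarrow> 'w list" where
  "subword_letters Q P = map (\<lambda>i. Q ! (i - 1)) (sorted_list_of_set P)"

definition represents ::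
  "('w, 'b) monoid_scheme \<Rightarrow> 'w set \<Rightarrow> 'w list \<Rightarrow> nat set \<Rightarrow> 'w \<Rightarrow> bool" where
  "represents W S Q P w \<longleftrightarrow> reduced_expression W S (subword_letters Q P) w"

definition subword_contains ::
  "('w, 'b) monoid_scheme \<Rightarrow> 'w set \<Rightarrow> 'w list \<Rightarrow> nat set \<Rightarrow> 'w \<Rightarrow> bool" where
  "subword_contains W S Q P w \<longleftrightarrow> (\<exists>P' \<subseteq> P. represents W S Q P' w)"

definition subword_complex ::
  "('w, 'b) monoid_scheme \<Rightarrow> 'w set \<Rightarrow> 'w list \<Rightarrow> 'w \<Rightarrow> nat set set" where
  "subword_complex W S Q w =
     {{1..length Q} - P | P. P \<subseteq> {1..length Q} \<and> subword_contains W S Q P w}"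

definition alexander_dual :: "nat \<Rightarrow> nat set set \<Rightarrow> nat set set" where
  "alexander_dual n \<Delta> = {{1..n} - F | F. F \<subseteq> {1..n} \<and> F \<notin> \<Delta>}"


section \<open>Polynomial rings and monomial ideals\<close>

text \<open>
  Polynomials are finitely supported functions from exponent vectors to coefficients; the
  ring \<open>k[x\<^sub>1,\<dots>,x\<^sub>n]\<close> consists of those that involve no variable other than \<open>x\<^sub>1,\<dots>,x\<^sub>n\<close>.
\<close>

type_synonym 'k mpoly = "(nat \<Rightarrow>\<^sub>0 nat) \<Rightarrow>\<^sub>0 'k"

definition poly_ring :: "nat \<Rightarrow> ('k::field) mpoly ring" where
  "poly_ring n =
     \<lparr>carrier = {p. \<forall>a \<in> Poly_Mapping.keys p. Poly_Mapping.keys a \<subseteq> {1..n}},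
      mult = (*), one = 1, zero = 0, add = (+)\<rparr>"

definition monomial :: "(nat \<Rightarrow>\<^sub>0 nat) \<Rightarrow> ('k::field) mpoly" where
  "monomial a = Poly_Mapping.single a 1"

definition var :: "nat \<Rightarrow> ('k::field) mpoly" where
  "var i = monomial (Poly_Mapping.single i 1)"

definition var_prod :: "nat set \<Rightarrow> ('k::field) mpoly" where
  "var_prod P = (\<Prod>i\<in>P. var i)"

text \<open>
  The library orders exponent vectors by comparing them at the least index at which they
  differ; this is the lexicographical order with \<open>x\<^sub>1 > x\<^sub>2 > \<dots>\<close>.
\<close>

definition lex_gt :: "('k::field) mpoly \<Rightarrow> 'k mpoly \<Rightarrow> bool" where
  "lex_gt u v \<longleftrightarrow> (\<exists>a b. u = monomial a \<and> v = monomial b \<and> b < a)"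

lemma exponent_less_iff:
  fixes a b :: "nat \<Rightarrow>\<^sub>0 nat"
  shows "b < a \<longleftrightarrow>
    (\<exists>i. Poly_Mapping.lookup b i < Poly_Mapping.lookup a i \<and>
         (\<forall>j < i. Poly_Mapping.lookup b j = Poly_Mapping.lookup a j))"
  by (simp add: less_poly_mapping.rep_eq less_fun_def)

text \<open>The minimal monomial generating set \<open>G(I)\<close> of a monomial ideal \<open>I\<close> is unique.\<close>

definition min_monomial_gens :: "nat \<Rightarrow> ('k::field) mpoly set \<Rightarrow> 'k mpoly set \<Rightarrow> bool" where
  "min_monomial_gens n I G \<longleftrightarrow>
     G \<subseteq> carrier (poly_ring n) \<inter> range monomial \<and>
     Idl\<^bsub>poly_ring n\<^esub> G = I \<and>
     (\<forall>H. H \<subset> G \<longrightarrow> Idl\<^bsub>poly_ring n\<^esub> H \<noteq> I)"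

definition stanley_reisner_ideal :: "nat \<Rightarrow> nat set set \<Rightarrow> ('k::field) mpoly set" where
  "stanley_reisner_ideal n \<Delta> = Idl\<^bsub>poly_ring n\<^esub> {var_prod F | F. F \<subseteq> {1..n} \<and> F \<notin> \<Delta>}"

definition colon_ideal :: "('a, 'b) ring_scheme \<Rightarrow> 'a set \<Rightarrow> 'a \<Rightarrow> 'a set" where
  "colon_ideal R I f = {g \<in> carrier R. g \<otimes>\<^bsub>R\<^esub> f \<in> I}"

text \<open>
  \<open>lq_set n us i\<close> is \<open>set(u\<^sub>i)\<close> for the sequence \<open>us = [u\<^sub>1,\<dots>,u\<^sub>r]\<close> and \<open>1 \<le> i \<le> r\<close>;
  thus \<open>u\<^sub>i\<close> is \<open>us ! (i - 1)\<close>, and \<open>take (i - 1) us\<close> consists of its predecessors.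
\<close>

definition lq_set :: "nat \<Rightarrow> ('k::field) mpoly list \<Rightarrow> nat \<Rightarrow> nat set" where
  "lq_set n us i =
     (if i = 1 then {}
      else {s \<in> {1..n}.
              var s \<in> colon_ideal (poly_ring n) (Idl\<^bsub>poly_ring n\<^esub> (set (take (i - 1) us)))
                        (us ! (i - 1))})"


section \<open>Complete intersections\<close>

definition regular_sequence :: "('a, 'b) ring_scheme \<Rightarrow> 'a list \<Rightarrow> bool" where
  "regular_sequence R fs \<longleftrightarrow>
     set fs \<subseteq> carrier R \<and>
     (\<forall>i < length fs. \<forall>g \<in> carrier R.
        g \<otimes>\<^bsub>R\<^esub> (fs ! i) \<in> Idl\<^bsub>R\<^esub> (set (take i fs)) \<longrightarrow> g \<in> Idl\<^bsub>R\<^esub> (set (take i fs))) \<and>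
     Idl\<^bsub>R\<^esub> (set fs) \<noteq> carrier R"

text \<open>
  The quotient ring \<open>R / I\<close> is a complete intersection with respect to its presentation as a
  quotient of \<open>R\<close>.
\<close>

definition complete_intersection_quotient :: "('a, 'b) ring_scheme \<Rightarrow> 'a set \<Rightarrow> bool" where
  "complete_intersection_quotient R I \<longleftrightarrow>
     (\<exists>fs. regular_sequence R fs \<and> Idl\<^bsub>R\<^esub> (set fs) = I)"

definition stanley_reisner_complete_intersection ::
  "'k::field itself \<Rightarrow> nat \<Rightarrow> nat set set \<Rightarrow> bool" where
  "stanley_reisner_complete_intersection (_ :: 'k itself) n \<Delta> \<longleftrightarrow>
     complete_intersection_quotient (poly_ring n)
       (stanley_reisner_ideal n \<Delta> :: 'k mpoly set)"

lemma poly_ring_simps [simp]: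
  "p \<otimes>\<^bsub>poly_ring n\<^esub> q = p * q" "p \<oplus>\<^bsub>poly_ring n\<^esub> q = p + q"
  "\<one>\<^bsub>poly_ring n\<^esub> = 1" "\<zero>\<^bsub>poly_ring n\<^esub> = 0"
  by (simp_all add: poly_ring_def)

lemma carrier_poly_ring:
  "carrier (poly_ring n) = {p. \<forall>a \<in> Poly_Mapping.keys p. Poly_Mapping.keys a \<subseteq> {1..n}}"
  by (simp add: poly_ring_def)

lemma poly_ring_add_closed:
  "p \<in> carrier (poly_ring n) \<Longrightarrow> q \<in> carrier (poly_ring n) \<Longrightarrow> p + q \<in> carrier (poly_ring n)"
  using Poly_Mapping.keys_add[of p q] by (fastforce simp: carrier_poly_ring)

lemma poly_ring_mult_closed:
  assumes "p \<in> carrier (poly_ring n)" "q \<in> carrier (poly_ring n)"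
  shows "p * q \<in> carrier (poly_ring n)"
proof -
  have "Poly_Mapping.keys c \<subseteq> {1..n}" if c: "c \<in> Poly_Mapping.keys (p * q)" for c
  proof -
    obtain a b where ab: "c = a + b" "a \<in> Poly_Mapping.keys p" "b \<in> Poly_Mapping.keys q"
      using subsetD[OF Poly_Mapping.keys_mult c] by auto
    have "Poly_Mapping.keys c \<subseteq> Poly_Mapping.keys a \<union> Poly_Mapping.keys b"
      unfolding ab(1) by (rule Poly_Mapping.keys_add)
    moreover have "Poly_Mapping.keys a \<subseteq> {1..n}" "Poly_Mapping.keys b \<subseteq> {1..n}"
      using ab(2,3) assms unfolding carrier_poly_ring by blast+
    ultimately show ?thesis by (meson Un_least order_trans)
  qed
  then show ?thesis by (simp add: carrier_poly_ring)
qed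

lemma one_poly_ring: "1 \<in> carrier (poly_ring n)"
  by (simp add: carrier_poly_ring)

lemma cring_poly_ring: "cring (poly_ring n :: 'k::field mpoly ring)"
proof (rule cringI)
  show "abelian_group (poly_ring n :: 'k mpoly ring)"
  proof (rule abelian_groupI)
    fix p :: "'k mpoly" assume p: "p \<in> carrier (poly_ring n)"
    show "\<exists>q \<in> carrier (poly_ring n). q \<oplus>\<^bsub>poly_ring n\<^esub> p = \<zero>\<^bsub>poly_ring n\<^esub>"
    proof
      show "- p \<in> carrier (poly_ring n)" using p by (simp add: carrier_poly_ring)
    qed simp
    show "\<zero>\<^bsub>poly_ring n\<^esub> \<oplus>\<^bsub>poly_ring n\<^esub> p = p" by simp
  next
    show "\<zero>\<^bsub>poly_ring n\<^esub> \<in> carrier (poly_ring n :: 'k mpoly ring)"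
      by (simp add: carrier_poly_ring)
  qed (simp_all add: poly_ring_add_closed add.assoc add.commute)
  show "Group.comm_monoid (poly_ring n :: 'k mpoly ring)"
    by (rule comm_monoidI)
      (simp_all add: poly_ring_mult_closed one_poly_ring mult.assoc mult.commute)
qed (simp add: distrib_right)

lemma var_carrier: "i \<in> {1..n} \<Longrightarrow> var i \<in> carrier (poly_ring n)"
  by (simp add: var_def monomial_def carrier_poly_ring)

lemma var_prod_carrier:
  assumes "P \<subseteq> {1..n}" shows "(var_prod P :: 'k::field mpoly) \<in> carrier (poly_ring n)"
proof -
  have "finite P" using assms finite_subset by blast
  then show ?thesis using assms
  proof (induction P)
    case empty
    then show ?case by (simp add: var_prod_def one_poly_ring)
  next
    case (insert i P)
    then have "var i * (var_prod P :: 'k mpoly) \<in> carrier (poly_ring n)"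
      by (intro poly_ring_mult_closed var_carrier) auto
    then show ?case using insert.hyps by (simp add: var_prod_def)
  qed
qed

text \<open>
  The Stanley--Reisner ideal of the Alexander dual of a subword complex is generated by the
  monomials of the subwords representing the given element.
\<close>

lemma stanley_reisner_ideal_dual_subword_complex:
  "(stanley_reisner_ideal (length Q) (alexander_dual (length Q) (subword_complex W S Q w))
      :: 'k::field mpoly set) =
   Idl\<^bsub>poly_ring (length Q)\<^esub> {var_prod P | P. P \<subseteq> {1..length Q} \<and> represents W S Q P w}"
  (is "?L = Idl\<^bsub>?R\<^esub> ?G")
proof -
  interpret cring ?R by (rule cring_poly_ring)
  let ?N = "{1..length Q}"
  have face: "?N - F \<in> subword_complex W S Q w \<longleftrightarrow> subword_contains W S Q F w"
    if "F \<subseteq> ?N" for F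
  proof
    assume "?N - F \<in> subword_complex W S Q w"
    then obtain P where "?N - F = ?N - P" "P \<subseteq> ?N" "subword_contains W S Q P w"
      unfolding subword_complex_def by blast
    moreover from this that have "F = P" by blast
    ultimately show "subword_contains W S Q F w" by simp
  qed (use that in \<open>auto simp: subword_complex_def\<close>)
  have nonface: "F \<notin> alexander_dual (length Q) (subword_complex W S Q w) \<longleftrightarrow>
      subword_contains W S Q F w" if F: "F \<subseteq> ?N" for F
  proof -
    have "F \<in> alexander_dual (length Q) (subword_complex W S Q w) \<longleftrightarrow>
        ?N - F \<notin> subword_complex W S Q w"
    proof
      assume "F \<in> alexander_dual (length Q) (subword_complex W S Q w)"
      then obtain E where E: "F = ?N - E" "E \<subseteq> ?N" "E \<notin> subword_complex W S Q w"
        unfolding alexander_dual_def by blast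
      then have "?N - F = E" by blast
      with E show "?N - F \<notin> subword_complex W S Q w" by simp
    next
      assume "?N - F \<notin> subword_complex W S Q w"
      moreover have "F = ?N - (?N - F)" using F by blast
      ultimately show "F \<in> alexander_dual (length Q) (subword_complex W S Q w)"
        unfolding alexander_dual_def by blast
    qed
    with face[OF F] show ?thesis by blast
  qed
  let ?H = "{var_prod F :: 'k mpoly | F. F \<subseteq> ?N \<and> subword_contains W S Q F w}"
  have L: "?L = Idl\<^bsub>?R\<^esub> ?H"
    unfolding stanley_reisner_ideal_def using nonface
    by (intro arg_cong[where f = "genideal ?R"]) blast
  have Gc: "?G \<subseteq> carrier ?R" and Hc: "?H \<subseteq> carrier ?R"
    using var_prod_carrier by blast+
  have I: "ideal (Idl\<^bsub>?R\<^esub> ?G) ?R" using genideal_ideal[OF Gc] .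
  have "?H \<subseteq> Idl\<^bsub>?R\<^esub> ?G"
  proof
    fix p assume "p \<in> ?H"
    then obtain F P where p: "p = var_prod F" "F \<subseteq> ?N" "P \<subseteq> F" "represents W S Q P w"
      unfolding subword_contains_def by blast
    then have "var_prod P \<in> Idl\<^bsub>?R\<^esub> ?G" using genideal_self[OF Gc] by blast
    moreover have "(var_prod (F - P) :: 'k mpoly) \<in> carrier ?R"
      using p by (intro var_prod_carrier) blast
    ultimately have "var_prod (F - P) \<otimes>\<^bsub>?R\<^esub> var_prod P \<in> Idl\<^bsub>?R\<^esub> ?G"
      using ideal.I_l_closed[OF I] by blast
    moreover have "(var_prod F :: 'k mpoly) = var_prod (F - P) * var_prod P"
      unfolding var_prod_def using p finite_subset[OF p(2)]
      by (intro prod.subset_diff) auto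
    ultimately show "p \<in> Idl\<^bsub>?R\<^esub> ?G" using p by simp
  qed
  then have "Idl\<^bsub>?R\<^esub> ?H \<subseteq> Idl\<^bsub>?R\<^esub> ?G" by (rule genideal_minimal[OF I])
  moreover have "?G \<subseteq> ?H" unfolding subword_contains_def by blast
  then have "Idl\<^bsub>?R\<^esub> ?G \<subseteq> Idl\<^bsub>?R\<^esub> ?H"
    by (intro genideal_minimal[OF genideal_ideal[OF Hc]] order_trans[OF _ genideal_self[OF Hc]])
  ultimately show ?thesis unfolding L by (rule subset_antisym)
qed

end

theory Submission
  imports Defs
begin

text \<open>
  All subwords representing \<open>\<pi>\<close> have \<open>\<ell>(\<pi>)\<close> letters, so they form an antichain and the sets
  \<open>P\<^sub>1, \<dots>, P\<^sub>r\<close> are exactly these subwords. Write \<open>R = P\<^sub>r\<close> for the lexicographically last one.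
  An element \<open>s\<close> of \<open>set(x\<^sub>R)\<close> comes from some \<open>P\<^sub>i\<close> with \<open>P\<^sub>i - R = {s}\<close>, that is,
  \<open>P\<^sub>i = R - t + s\<close> with \<open>t \<in> R\<close>, and \<open>s < t\<close> because \<open>P\<^sub>i\<close> precedes \<open>R\<close>. Since there are \<open>r - 1\<close>
  such \<open>s\<close>, every representing subword other than \<open>R\<close> has this form.

  The point is that \<open>t\<close> does not depend on \<open>s\<close>. Suppose that \<open>R - t\<^sub>1 + s\<^sub>1\<close> and \<open>R - t\<^sub>2 + s\<^sub>2\<close>
  represent \<open>\<pi>\<close> with \<open>s\<^sub>1 < s\<^sub>2 < t\<^sub>2\<close> and \<open>t\<^sub>1 \<noteq> t\<^sub>2\<close>. The reflection \<open>\<rho>\<close> attached to \<open>s\<^sub>1\<close> equals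
  the one attached to \<open>t\<^sub>1\<close>, so it is an inversion of \<open>\<pi>\<close>. Hence it is also attached to some
  position \<open>q\<close> of the other reduced word \<open>N = R - t\<^sub>2 + s\<^sub>2\<close>. As \<open>N\<close> agrees with \<open>R\<close> to the left of
  \<open>s\<^sub>1\<close>, the set \<open>N - q + s\<^sub>1\<close> represents \<open>\<pi>\<close>, and \<open>q \<noteq> s\<^sub>2\<close> because the positions of \<open>R\<close> have
  distinct reflections (lemma \<open>double_exchange\<close>). So some representing subword contains two
  positions outside \<open>R\<close>, which is impossible. That the inversions depend only on \<open>\<pi>\<close> is derived
  from the presentation of \<open>W\<close>: the parity of the number of occurrences of a given reflection in
  a word is unchanged by the relations (lemma \<open>even_count_reflections\<close>).

  With one common \<open>t\<close>, and \<open>D\<close> the set of all \<open>s\<close>, a set of positions is a nonface iff it meets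
  every representing subword, that is, iff it meets \<open>R - t\<close> or contains \<open>D + t\<close>. So \<open>I\<^sub>\<Delta>\<close> is
  generated by the variables of \<open>R - t\<close> and the product of the variables of \<open>D + t\<close>. Monomials
  in disjoint sets of variables form a regular sequence. If \<open>R\<close> is empty, then \<open>I\<^sub>\<Delta> = 0\<close>.
\<close>

section \<open>Reflections of words in a Coxeter group\<close>

locale coxeter_group =
  fixes W :: "('w, 'b) monoid_scheme" (structure) and S :: "'w set"
  assumes coxeter: "coxeter_system W S"
begin

lemma presentation: obtains m where "coxeter_matrix S m" "presented_by W S (coxeter_relators S m)"
  using coxeter unfolding coxeter_system_def by blast

sublocale group W
  using presentation unfolding presented_by_def by blast

lemma inv_cancel:
  assumes "g \<in> carrier W" "x \<in> carrier W"
  shows "g \<otimes> (inv g \<otimes> x) = x" "inv g \<otimes> (g \<otimes> x) = x"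
  using assms by (simp_all flip: m_assoc)

lemma generator_closed [simp]: "s \<in> S \<Longrightarrow> s \<in> carrier W"
  by (rule presentation) (auto simp: presented_by_def)

lemma gword_eval_relator:
  assumes "presented_by W S R" "\<rho> \<in> R" "\<rho> \<in> lists (S \<times> UNIV)"
  shows "gword_eval W \<rho> = \<one>"
proof -
  have "relator_cong S R ([] @ \<rho> @ []) ([] @ [])"
    using assms(2) by (rule relator_cong.relator)
  then have "gword_eval W \<rho> = gword_eval W []"
    using assms(1,3) unfolding presented_by_def by auto
  then show ?thesis by (simp add: gword_eval_def)
qed

lemma generator_square [simp]:
  assumes "s \<in> S" shows "s \<otimes> s = \<one>"
proof -
  obtain m where m: "coxeter_matrix S m" "presented_by W S (coxeter_relators S m)"
    by (rule presentation)
  have "m s s = enat 1"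
    using m(1) assms unfolding coxeter_matrix_def by (simp add: one_enat_def)
  then have "[(s, True), (s, True)] \<in> coxeter_relators S m"
    unfolding coxeter_relators_def using assms
    by (intro CollectI exI[of _ s] exI[of _ 1]) simp
  from gword_eval_relator[OF m(2) this] show ?thesis
    using assms by (simp add: gword_eval_def)
qed

lemma generator_inv [simp]: "s \<in> S \<Longrightarrow> inv s = s"
  by (intro inv_equality) auto

lemma involutions_cancel_iff:
  assumes closed: "a \<in> carrier W" "b \<in> carrier W" "x \<in> carrier W"
    and square: "a \<otimes> a = \<one>" "b \<otimes> b = \<one>"
  shows "a \<otimes> b \<otimes> x = x \<longleftrightarrow> a = b"
proof -
  have "a \<otimes> b \<otimes> x = x \<longleftrightarrow> a \<otimes> b = \<one>"
    using closed by (intro r_cancel_one) auto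
  also have "\<dots> \<longleftrightarrow> a \<otimes> b = b \<otimes> b" by (simp add: square)
  also have "\<dots> \<longleftrightarrow> a = b" using closed by (intro right_cancel) auto
  finally show ?thesis .
qed

lemma word_prod_Nil [simp]: "word_prod W [] = \<one>"
  and word_prod_Cons [simp]: "word_prod W (s # ws) = s \<otimes> word_prod W ws"
  by (simp_all add: word_prod_def)

lemma word_prod_closed [simp]: "ws \<in> lists S \<Longrightarrow> word_prod W ws \<in> carrier W"
  by (induction ws) auto

lemma word_prod_append:
  "u \<in> lists S \<Longrightarrow> v \<in> lists S \<Longrightarrow> word_prod W (u @ v) = word_prod W u \<otimes> word_prod W v"
  by (induction u) (auto simp: m_assoc)

lemma gword_eval_eq_word_prod:
  "u \<in> lists (S \<times> UNIV) \<Longrightarrow> gword_eval W u = word_prod W (map fst u)"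
  by (induction u) (auto simp: gword_eval_def)

text \<open>
  The letter \<open>s\<close> of \<open>u @ [s] @ v\<close> contributes the reflection \<open>u s u\<^sup>-\<^sup>1\<close>. Multiplication by it
  from the left deletes that letter. The recursion conjugates the reflections of
  the tail by the first letter, which is its own inverse.
\<close>

primrec reflections :: "'w list \<Rightarrow> 'w list" where
  "reflections [] = []"
| "reflections (s # ws) = s # map (\<lambda>t. s \<otimes> t \<otimes> s) (reflections ws)"

lemma reflections_closed: "ws \<in> lists S \<Longrightarrow> set (reflections ws) \<subseteq> carrier W"
  by (induction ws) auto

lemma reflections_append:
  assumes "u \<in> lists S" "v \<in> lists S"
  shows "reflections (u @ v) =
    reflections u @ map (\<lambda>t. word_prod W u \<otimes> t \<otimes> inv (word_prod W u)) (reflections v)"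
  using assms(1)
proof (induction u)
  case Nil
  then show ?case using reflections_closed[OF assms(2)]
    by (auto intro!: map_idI[symmetric])
next
  case (Cons s u)
  have "\<forall>x \<in> set (reflections v). x \<in> carrier W" using reflections_closed[OF assms(2)] by blast
  then show ?case using Cons by (auto simp: inv_mult_group m_assoc)
qed

lemma count_conjugate:
  assumes "g \<in> carrier W" "t \<in> carrier W" "set xs \<subseteq> carrier W"
  shows "count_list (map (\<lambda>x. g \<otimes> x \<otimes> inv g) xs) t = count_list xs (inv g \<otimes> t \<otimes> g)"
proof -
  have "g \<otimes> x \<otimes> inv g = t \<longleftrightarrow> x = inv g \<otimes> t \<otimes> g" if "x \<in> carrier W" for x
  proof
    show "g \<otimes> x \<otimes> inv g = t \<Longrightarrow> x = inv g \<otimes> t \<otimes> g"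
      using assms(1) that by (auto simp: m_assoc inv_cancel)
    show "x = inv g \<otimes> t \<otimes> g \<Longrightarrow> g \<otimes> x \<otimes> inv g = t"
      using assms(1,2) that by (auto simp: m_assoc inv_cancel)
  qed
  then show ?thesis using assms(3) by (induction xs) auto
qed

text \<open>
  The first two letters contribute \<open>s\<close> and \<open>s t s\<close>. With \<open>x = s t\<close>, conjugation by \<open>x\<close> takes
  \<open>x\<^sup>j s\<close> to \<open>x\<^sup>j\<^sup>+\<^sup>2 s\<close>, because \<open>s\<close> conjugates \<open>x\<close> to its inverse.
\<close>

lemma reflections_dihedral:
  assumes "s \<in> S" "t \<in> S"
  shows "reflections (concat (replicate k [s, t])) =
    map (\<lambda>j. (s \<otimes> t) [^] j \<otimes> s) [0..<2 * k]"
proof (induction k)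
  case (Suc k)
  have st: "s \<in> carrier W" "t \<in> carrier W" using assms by auto
  have conj: "s \<otimes> (t \<otimes> ((s \<otimes> t) [^] j \<otimes> s) \<otimes> t) \<otimes> s = (s \<otimes> t) [^] (j + 2) \<otimes> s" for j :: nat
  proof -
    define y where "y = (s \<otimes> t) [^] j"
    have y: "y \<in> carrier W" using st by (simp add: y_def)
    have "(s \<otimes> t) [^] (j + 2) = (s \<otimes> t) \<otimes> (y \<otimes> (s \<otimes> t))"
      using st nat_pow_Suc2[of "s \<otimes> t" "Suc j"] by (simp add: y_def)
    then show ?thesis unfolding y_def[symmetric] using st y by (simp add: m_assoc)
  qed
  have "[0..<2 * Suc k] = [0, 1] @ map (\<lambda>j. j + 2) [0..<2 * k]"
    unfolding map_add_upt by (simp add: upt_conv_Cons numeral_2_eq_2 del: upt_Suc)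
  then show ?case using Suc st assms by (simp add: conj comp_def del: upt_Suc)
qed simp

text \<open>
  Since \<open>(s t)\<^sup>k = 1\<close>, the list of reflections of the relator runs twice through the same \<open>k\<close>
  elements.
\<close>

lemma even_count_relator:
  assumes "s \<in> S" "t \<in> S" "(s \<otimes> t) [^] k = \<one>"
  shows "even (count_list (reflections (concat (replicate k [s, t]))) r)"
proof -
  let ?f = "\<lambda>j. (s \<otimes> t) [^] (j :: nat) \<otimes> s"
  have "?f (j + k) = ?f j" for j
    using assms by (simp flip: nat_pow_mult)
  then have "map ?f (map (\<lambda>j. j + k) [0..<k]) = map ?f [0..<k]" by simp
  moreover have "[0..<2 * k] = [0..<k] @ map (\<lambda>j. j + k) [0..<k]"
    unfolding map_add_upt mult_2 by (rule upt_add_eq_append) simp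
  ultimately have "map ?f [0..<2 * k] = map ?f [0..<k] @ map ?f [0..<k]"
    by (metis map_append)
  then show ?thesis
    unfolding reflections_dihedral[OF assms(1,2)] by simp
qed

lemma map_fst_lists: "u \<in> lists (S \<times> UNIV) \<Longrightarrow> map fst u \<in> lists S"
  by (induction u) auto

lemma word_prod_dihedral:
  assumes "s \<in> S" "t \<in> S"
  shows "word_prod W (concat (replicate k [s, t])) = (s \<otimes> t) [^] k"
proof (induction k)
  case (Suc k)
  have "s \<in> carrier W" "t \<in> carrier W" using assms by auto
  then show ?case using Suc nat_pow_Suc2[of "s \<otimes> t" k] by (simp add: m_assoc)
qed simp

text \<open>
  A subword that evaluates to \<open>1\<close> contributes conjugates of its own reflections and leaves those
  of the letters on both sides unchanged.
\<close>

lemma count_reflections_insert: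
  assumes "u \<in> lists S" "\<rho> \<in> lists S" "v \<in> lists S" "word_prod W \<rho> = \<one>" "t \<in> carrier W"
    and even: "\<And>t. t \<in> carrier W \<Longrightarrow> even (count_list (reflections \<rho>) t)"
  shows "even (count_list (reflections (u @ \<rho> @ v)) t) =
    even (count_list (reflections (u @ v)) t)"
proof -
  let ?c = "\<lambda>g. map (\<lambda>t. g \<otimes> t \<otimes> inv g)"
  have "?c \<one> (reflections v) = reflections v"
    using reflections_closed[OF assms(3)] by (auto intro!: map_idI)
  then have "reflections (u @ \<rho> @ v) =
      reflections u @ ?c (word_prod W u) (reflections \<rho>) @ ?c (word_prod W u) (reflections v)"
    using assms by (simp add: reflections_append)
  moreover have "even (count_list (?c (word_prod W u) (reflections \<rho>)) t)"
    using assms by (subst count_conjugate) (auto simp: reflections_closed)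
  ultimately show ?thesis using assms(1,3) by (simp add: reflections_append)
qed

text \<open>
  Both elementary steps of the congruence delete a factor of the kind just treated. The
  first conjunct is carried along because a congruence may pass through intermediate words, which
  must also be words in \<open>S\<close>.
\<close>

lemma count_reflections_cong:
  assumes m: "presented_by W S (coxeter_relators S m)"
    and "relator_cong S (coxeter_relators S m) u v" and t: "t \<in> carrier W"
  shows "(u \<in> lists (S \<times> UNIV) \<longleftrightarrow> v \<in> lists (S \<times> UNIV)) \<and>
    (u \<in> lists (S \<times> UNIV) \<longrightarrow> even (count_list (reflections (map fst u)) t) =
      even (count_list (reflections (map fst v)) t))"
  using assms(2)
proof induction
  case (cancel s u b v)
  show ?case
  proof (intro conjI impI)
    assume "u @ [(s, b), (s, \<not> b)] @ v \<in> lists (S \<times> UNIV)"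
    then have "map fst u \<in> lists S" "map fst v \<in> lists S" by (auto intro!: map_fst_lists)
    then show "even (count_list (reflections (map fst (u @ [(s, b), (s, \<not> b)] @ v))) t) =
        even (count_list (reflections (map fst (u @ v))) t)"
      using cancel t count_reflections_insert[of "map fst u" "[s, s]" "map fst v" t]
      by simp
  qed (use cancel in auto)
next
  case (relator \<rho> u v)
  then obtain s s' k where \<rho>: "\<rho> = concat (replicate k [(s, True), (s', True)])"
    and S: "s \<in> S" "s' \<in> S" unfolding coxeter_relators_def by blast
  have L: "\<rho> \<in> lists (S \<times> UNIV)" using S unfolding \<rho> by (induction k) auto
  have fst: "map fst \<rho> = concat (replicate k [s, s'])" unfolding \<rho> by (simp add: map_concat)
  have one: "word_prod W (map fst \<rho>) = \<one>"
    using gword_eval_relator[OF m relator L] gword_eval_eq_word_prod[OF L] by simp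
  show ?case
  proof (intro conjI impI)
    assume "u @ \<rho> @ v \<in> lists (S \<times> UNIV)"
    then have "map fst u \<in> lists S" "map fst v \<in> lists S" "map fst \<rho> \<in> lists S"
      by (auto intro!: map_fst_lists)
    then show "even (count_list (reflections (map fst (u @ \<rho> @ v))) t) =
        even (count_list (reflections (map fst (u @ v))) t)"
      using t one count_reflections_insert[of "map fst u" "map fst \<rho>" "map fst v" t]
        even_count_relator[OF S] S fst word_prod_dihedral by simp
  qed (use L in auto)
qed auto

text \<open>
  The parity tells whether a reflection is an inversion of the element. It replaces an
  argument with lengths: a reflection occurring exactly once in one word for \<open>w\<close> occurs in every
  word for \<open>w\<close>, which yields the strong exchange property.
\<close>

lemma even_count_reflections:
  assumes "u \<in> lists S" "v \<in> lists S" "word_prod W u = word_prod W v" "t \<in> carrier W"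
  shows "even (count_list (reflections u) t) = even (count_list (reflections v) t)"
proof -
  obtain m where m: "presented_by W S (coxeter_relators S m)" by (rule presentation)
  let ?p = "map (\<lambda>s. (s, True))"
  have L: "?p u \<in> lists (S \<times> UNIV)" "?p v \<in> lists (S \<times> UNIV)" using assms by auto
  then have "gword_eval W (?p u) = gword_eval W (?p v)"
    using assms by (simp add: gword_eval_eq_word_prod comp_def)
  then have "relator_cong S (coxeter_relators S m) (?p u) (?p v)"
    using m L unfolding presented_by_def by blast
  from count_reflections_cong[OF m this assms(4)] L show ?thesis by (simp add: comp_def)
qed

end

section \<open>Exchange in subwords\<close>

lemma sorted_list_of_set_Un:
  fixes A B :: "nat set"
  assumes "finite A" "finite B" "\<And>a b. a \<in> A \<Longrightarrow> b \<in> B \<Longrightarrow> a < b"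
  shows "sorted_list_of_set (A \<union> B) = sorted_list_of_set A @ sorted_list_of_set B"
proof (rule sorted_distinct_set_unique)
  show "sorted (sorted_list_of_set A @ sorted_list_of_set B)"
    using assms by (auto simp: sorted_append less_imp_le)
  show "distinct (sorted_list_of_set A @ sorted_list_of_set B)"
    using assms by fastforce
qed (use assms in auto)

locale coxeter_word = coxeter_group +
  fixes Q :: "'a list"
  assumes word: "Q \<in> lists S"
begin

abbreviation subword_prod :: "nat set \<Rightarrow> 'a" where
  "subword_prod P \<equiv> word_prod W (subword_letters Q P)"

text \<open>
  The reflection of a position \<open>i\<close> relative to \<open>P\<close> depends only on the letters of \<open>P\<close> before
  \<open>i\<close>; it makes sense for positions outside \<open>P\<close> as well, and then it says what inserting the
  letter does.
\<close>

definition root_refl :: "nat set \<Rightarrow> nat \<Rightarrow> 'a" where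
  "root_refl P i =
     subword_prod (P \<inter> {..<i}) \<otimes> Q ! (i - 1) \<otimes> inv (subword_prod (P \<inter> {..<i}))"

lemma letter_mem: "i \<in> {1..length Q} \<Longrightarrow> Q ! (i - 1) \<in> S"
  using word nth_mem[of "i - 1" Q] by (auto simp: in_lists_conv_set simp del: nth_mem)

lemma subword_letters_lists: "P \<subseteq> {1..length Q} \<Longrightarrow> subword_letters Q P \<in> lists S"
  using letter_mem finite_subset[of P "{1..length Q}"]
  by (auto simp: subword_letters_def in_lists_conv_set)

lemma subword_prod_closed: "P \<subseteq> {1..length Q} \<Longrightarrow> subword_prod P \<in> carrier W"
  by (simp add: subword_letters_lists)

lemma subword_letters_Un:
  assumes "A \<union> B \<subseteq> {1..length Q}" "\<And>a b. a \<in> A \<Longrightarrow> b \<in> B \<Longrightarrow> a < b"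
  shows "subword_letters Q (A \<union> B) = subword_letters Q A @ subword_letters Q B"
proof -
  have "finite A" "finite B" using assms(1) finite_subset by blast+
  then show ?thesis using assms by (simp add: subword_letters_def sorted_list_of_set_Un)
qed

lemma subword_prod_Un:
  assumes "A \<union> B \<subseteq> {1..length Q}" "\<And>a b. a \<in> A \<Longrightarrow> b \<in> B \<Longrightarrow> a < b"
  shows "subword_prod (A \<union> B) = subword_prod A \<otimes> subword_prod B"
  using assms by (subst subword_letters_Un) (auto simp: word_prod_append subword_letters_lists)

lemma root_refl_closed:
  assumes "P \<subseteq> {1..length Q}" "i \<in> {1..length Q}"
  shows "root_refl P i \<in> carrier W"
proof -
  have "P \<inter> {..<i} \<subseteq> {1..length Q}" using assms(1) by blast
  then show ?thesis
    using assms(2) letter_mem[of i] subword_prod_closed unfolding root_refl_def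
    by (intro m_closed inv_closed) auto
qed

lemma root_refl_square:
  assumes "P \<subseteq> {1..length Q}" "i \<in> {1..length Q}"
  shows "root_refl P i \<otimes> root_refl P i = \<one>"
proof -
  define g where "g = subword_prod (P \<inter> {..<i})"
  define s where "s = Q ! (i - 1)"
  have "g \<in> carrier W" "s \<in> S"
    using assms letter_mem[of i] subword_prod_closed[of "P \<inter> {..<i}"] by (auto simp: g_def s_def)
  moreover have "g \<otimes> s \<otimes> inv g \<otimes> (g \<otimes> s \<otimes> inv g) = g \<otimes> (s \<otimes> (inv g \<otimes> (g \<otimes> (s \<otimes> inv g))))"
    using calculation by (simp add: m_assoc)
  ultimately show ?thesis
    unfolding root_refl_def g_def[symmetric] s_def[symmetric]
    by (simp add: m_assoc[symmetric])
qed

lemma root_refl_cong: "P \<inter> {..<i} = P' \<inter> {..<i} \<Longrightarrow> root_refl P i = root_refl P' i"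
  by (simp add: root_refl_def)

lemma subword_prod_insert:
  assumes P: "P \<subseteq> {1..length Q}" and i: "i \<in> {1..length Q}" "i \<notin> P"
  shows "subword_prod (insert i P) = root_refl P i \<otimes> subword_prod P"
proof -
  define A where "A = P \<inter> {..<i}"
  define C where "C = P \<inter> {i<..}"
  have AC: "A \<union> C = P" using i unfolding A_def C_def by auto (metis linorder_neqE_nat)
  then have sub: "A \<subseteq> {1..length Q}" "C \<subseteq> {1..length Q}" using P by auto
  have "subword_prod (A \<union> ({i} \<union> C)) = subword_prod A \<otimes> subword_prod ({i} \<union> C)"
    using sub i by (intro subword_prod_Un) (auto simp: A_def C_def)
  also have "subword_prod ({i} \<union> C) = subword_prod {i} \<otimes> subword_prod C"
    using sub i by (intro subword_prod_Un) (auto simp: A_def C_def)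
  also have "subword_prod {i} = Q ! (i - 1)"
    using letter_mem[OF i(1)] by (simp add: subword_letters_def)
  also have "A \<union> ({i} \<union> C) = insert i P" using AC by blast
  finally have 1: "subword_prod (insert i P) = subword_prod A \<otimes> (Q ! (i - 1) \<otimes> subword_prod C)" .
  have 2: "subword_prod P = subword_prod A \<otimes> subword_prod C"
    using sub unfolding AC[symmetric] by (intro subword_prod_Un) (auto simp: A_def C_def)
  show ?thesis
    unfolding 1 2 root_refl_def A_def[symmetric]
    using letter_mem[OF i(1)] subword_prod_closed[OF sub(1)] subword_prod_closed[OF sub(2)]
    by (simp add: m_assoc) (simp flip: m_assoc)
qed

lemma subword_prod_remove:
  assumes P: "P \<subseteq> {1..length Q}" and j: "j \<in> P"
  shows "subword_prod (P - {j}) = root_refl P j \<otimes> subword_prod P"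
proof -
  have j': "j \<in> {1..length Q}" using P j by blast
  have P': "P - {j} \<subseteq> {1..length Q}" using P by blast
  have "root_refl (P - {j}) j = root_refl P j" by (rule root_refl_cong) auto
  moreover have "subword_prod P = root_refl (P - {j}) j \<otimes> subword_prod (P - {j})"
    using subword_prod_insert[OF P' j'] j by (simp add: insert_absorb)
  ultimately show ?thesis
    using root_refl_closed[OF P j'] subword_prod_closed[OF P'] root_refl_square[OF P j']
    by (simp flip: m_assoc)
qed

text \<open>
  Insertion and deletion both multiply by a reflection from the left. The change that is made
  further to the left in the word is made second: the letters before it are still those of \<open>P\<close>,
  so both reflections can be taken relative to \<open>P\<close>.
\<close>

lemma subword_prod_exchange:
  assumes P: "P \<subseteq> {1..length Q}" and i: "i \<in> {1..length Q}" "i \<notin> P" and j: "j \<in> P"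
  shows "subword_prod (insert i (P - {j})) = subword_prod P \<longleftrightarrow> root_refl P i = root_refl P j"
proof -
  let ?ri = "root_refl P i" and ?rj = "root_refl P j"
  have j': "j \<in> {1..length Q}" using P j by blast
  note closed = root_refl_closed[OF P i(1)] root_refl_closed[OF P j'] subword_prod_closed[OF P]
  note square = root_refl_square[OF P i(1)] root_refl_square[OF P j']
  consider "i < j" | "j < i" using i j by (metis linorder_neqE_nat)
  then have "subword_prod (insert i (P - {j})) = ?ri \<otimes> ?rj \<otimes> subword_prod P \<or>
      subword_prod (insert i (P - {j})) = ?rj \<otimes> ?ri \<otimes> subword_prod P"
  proof cases
    case 1
    have "subword_prod (insert i (P - {j})) = root_refl (P - {j}) i \<otimes> subword_prod (P - {j})"
      using P i by (intro subword_prod_insert) auto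
    also have "root_refl (P - {j}) i = ?ri" using 1 by (intro root_refl_cong) auto
    also have "subword_prod (P - {j}) = ?rj \<otimes> subword_prod P"
      using P j by (rule subword_prod_remove)
    finally show ?thesis using m_assoc[OF closed] by simp
  next
    case 2
    have "insert i (P - {j}) = insert i P - {j}" using i j by auto
    moreover have "subword_prod (insert i P - {j}) =
        root_refl (insert i P) j \<otimes> subword_prod (insert i P)"
      using P i j by (intro subword_prod_remove) auto
    moreover have "root_refl (insert i P) j = ?rj" using 2 by (intro root_refl_cong) auto
    moreover have "subword_prod (insert i P) = ?ri \<otimes> subword_prod P"
      using P i by (rule subword_prod_insert)
    ultimately show ?thesis using m_assoc[OF closed(2,1,3)] by simp
  qed
  then show ?thesis
    using involutions_cancel_iff[OF closed square]
      involutions_cancel_iff[OF closed(2,1,3) square(2,1)] by metis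
qed

lemma reflections_subword:
  assumes "P \<subseteq> {1..length Q}"
  shows "reflections (subword_letters Q P) = map (root_refl P) (sorted_list_of_set P)"
proof -
  have "finite P" using assms finite_subset by blast
  then show ?thesis using assms
  proof (induction rule: finite_linorder_max_induct)
    case empty
    then show ?case by (simp add: subword_letters_def)
  next
    case (insert b A)
    have b: "b \<notin> A" using insert by blast
    have s: "sorted_list_of_set (A \<union> {b}) = sorted_list_of_set A @ [b]"
      using insert by (subst sorted_list_of_set_Un) auto
    have l: "subword_letters Q (A \<union> {b}) = subword_letters Q A @ [Q ! (b - 1)]"
      using insert by (subst subword_letters_Un) (auto simp: subword_letters_def)
    have r: "root_refl (A \<union> {b}) i = root_refl A i" if "i \<in> A" for i
      using insert that by (intro root_refl_cong) auto
    have "insert b A \<inter> {..<b} = A" using insert by auto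
    then have rb: "root_refl (insert b A) b = subword_prod A \<otimes> Q ! (b - 1) \<otimes> inv subword_prod A"
      unfolding root_refl_def by simp
    have "map (root_refl (A \<union> {b})) (sorted_list_of_set A) =
        map (root_refl A) (sorted_list_of_set A)"
      using r insert.hyps(1) by (intro map_cong) auto
    then show ?case
      using insert letter_mem[of b] subword_letters_lists[of A] rb l s
      by (simp add: reflections_append)
  qed
qed

lemma represents_iff:
  assumes "P \<subseteq> {1..length Q}"
  shows "represents W S Q P w \<longleftrightarrow> subword_prod P = w \<and> card P = cox_length W S w"
  using subword_letters_lists[OF assms]
  by (simp add: represents_def reduced_expression_def)
    (simp add: subword_letters_def)

lemma cox_length_subword_le:
  assumes "P \<subseteq> {1..length Q}" shows "cox_length W S (subword_prod P) \<le> card P"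
proof -
  have "length (subword_letters Q P) = card P" by (simp add: subword_letters_def)
  then show ?thesis
    unfolding cox_length_def using subword_letters_lists[OF assms]
    by (intro Least_le) blast
qed

text \<open>Deleting two positions with the same reflection would give a shorter word for \<open>w\<close>.\<close>

lemma root_refl_inj:
  assumes P: "P \<subseteq> {1..length Q}" and rep: "represents W S Q P w"
  shows "inj_on (root_refl P) P"
proof (rule linorder_inj_onI')
  fix i j assume ij: "i \<in> P" "j \<in> P" "i < j"
  show "root_refl P i \<noteq> root_refl P j"
  proof
    assume eq: "root_refl P i = root_refl P j"
    have i: "i \<in> {1..length Q}" using P ij by blast
    have "subword_prod (P - {j} - {i}) = root_refl (P - {j}) i \<otimes> subword_prod (P - {j})"
      using P ij by (intro subword_prod_remove) auto
    also have "root_refl (P - {j}) i = root_refl P i" using ij by (intro root_refl_cong) auto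
    also have "subword_prod (P - {j}) = root_refl P j \<otimes> subword_prod P"
      using P ij by (intro subword_prod_remove) auto
    finally have "subword_prod (P - {j} - {i}) = subword_prod P"
      using m_assoc[OF root_refl_closed[OF P i] root_refl_closed[OF P i] subword_prod_closed[OF P]]
        root_refl_square[OF P i] subword_prod_closed[OF P] eq by simp
    then have "card P \<le> card (P - {j} - {i})"
      using rep cox_length_subword_le[of "P - {j} - {i}"] P represents_iff[OF P] by auto
    moreover have "card (P - {j} - {i}) < card P"
      using ij finite_subset[OF P] by (intro psubset_card_mono) auto
    ultimately show False by simp
  qed
qed

text \<open>
  The two exchanges can be combined, though not by simply doing both: \<open>s\<^sub>1\<close> is inserted into the
  word \<open>N\<close> obtained by the second exchange, and the letter \<open>q\<close> that it displaces from \<open>N\<close> need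
  not be \<open>t\<^sub>1\<close>. The order of the positions makes \<open>P\<close> and \<open>N\<close> agree before \<open>s\<^sub>1\<close> and before \<open>s\<^sub>2\<close>.
\<close>

lemma double_exchange:
  assumes P: "P \<subseteq> {1..length Q}" "represents W S Q P w"
    and pos: "s1 \<in> {1..length Q}" "s2 \<in> {1..length Q}" "s1 \<notin> P" "s2 \<notin> P" "t1 \<in> P" "t2 \<in> P"
    and order: "s1 < s2" "s2 < t2" and "t1 \<noteq> t2"
    and e1: "represents W S Q (insert s1 (P - {t1})) w"
    and e2: "represents W S Q (insert s2 (P - {t2})) w"
  shows "\<exists>P' \<subseteq> {1..length Q}. represents W S Q P' w \<and> s1 \<in> P' \<and> s2 \<in> P'"
proof -
  define N where "N = insert s2 (P - {t2})"
  have N: "N \<subseteq> {1..length Q}" using P pos by (auto simp: N_def)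
  have fin: "finite P" "finite N" using P(1) N finite_subset by blast+
  have w: "subword_prod P = w" "subword_prod N = w" "card N = cox_length W S w"
    using P e2 N by (auto simp: represents_iff N_def)
  have "insert s1 (P - {t1}) \<subseteq> {1..length Q}" using P pos by auto
  then have r1: "root_refl P s1 = root_refl P t1"
    using e1 w(1) subword_prod_exchange[OF P(1) pos(1,3,5)] by (simp add: represents_iff)
  have r2: "root_refl P s2 = root_refl P t2"
    using w subword_prod_exchange[OF P(1) pos(2,4,6)] by (simp add: N_def)
  let ?r = "root_refl P t1"
  have closed: "?r \<in> carrier W" using P pos by (intro root_refl_closed) auto
  \<comment> \<open>The reflection of \<open>t1\<close> is an inversion of \<open>w\<close>, so it occurs in the word \<open>N\<close> too.\<close>
  have "count_list (reflections (subword_letters Q P)) ?r = 1"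
    unfolding reflections_subword[OF P(1)]
    using count_list_inj_map[of "root_refl P" "sorted_list_of_set P" t1]
      root_refl_inj[OF P] fin(1) pos(5)
    by (simp add: count_list_eq_length_filter distinct_length_filter)
  then have "odd (count_list (reflections (subword_letters Q N)) ?r)"
    using even_count_reflections[of "subword_letters Q P" "subword_letters Q N" ?r]
      subword_letters_lists P(1) N w closed by simp
  then have "?r \<in> root_refl N ` N"
    using fin(2) unfolding reflections_subword[OF N]
    by (metis count_list_0_iff even_zero set_map set_sorted_list_of_set)
  then obtain q where q: "q \<in> N" "root_refl N q = ?r" by force
  have s1N: "root_refl N s1 = ?r" "s1 \<notin> N"
    unfolding r1[symmetric] N_def using order pos by (auto intro!: root_refl_cong)
  \<comment> \<open>The position \<open>s2\<close> of \<open>N\<close> carries the reflection of \<open>t2\<close>, hence not that of \<open>t1\<close>.\<close>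
  have "root_refl N s2 = root_refl P s2"
    unfolding N_def using order by (intro root_refl_cong) auto
  then have "q \<noteq> s2"
    using q(2) r2 root_refl_inj[OF P] \<open>t1 \<noteq> t2\<close> pos(5,6) by (auto dest: inj_onD)
  have "subword_prod (insert s1 (N - {q})) = w"
    using subword_prod_exchange[OF N pos(1) s1N(2) q(1)] s1N q w by simp
  moreover have "card (insert s1 (N - {q})) = card N"
    using fin(2) s1N(2) q(1) by (metis DiffD1 card_Suc_Diff1 card_insert_disjoint finite_Diff)
  moreover have sub: "insert s1 (N - {q}) \<subseteq> {1..length Q}" using N pos by auto
  ultimately have "represents W S Q (insert s1 (N - {q})) w"
    using w(3) by (simp add: represents_iff)
  moreover have "s2 \<in> insert s1 (N - {q})" using \<open>q \<noteq> s2\<close> by (simp add: N_def)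
  ultimately show ?thesis using sub by blast
qed

end

section \<open>Ideals generated by squarefree monomials\<close>

definition indicator_exp :: "nat set \<Rightarrow> nat \<Rightarrow>\<^sub>0 nat" where
  "indicator_exp A = (\<Sum>i\<in>A. Poly_Mapping.single i 1)"

lemma lookup_indicator_exp:
  "finite A \<Longrightarrow> Poly_Mapping.lookup (indicator_exp A) i = (if i \<in> A then 1 else 0)"
  by (simp add: indicator_exp_def lookup_sum lookup_single when_def)

lemma keys_indicator_exp: "finite A \<Longrightarrow> Poly_Mapping.keys (indicator_exp A) = A"
  by (auto simp: in_keys_iff lookup_indicator_exp split: if_splits)

lemma var_prod_eq_monomial:
  assumes "finite A" shows "(var_prod A :: 'k::field mpoly) = monomial (indicator_exp A)"
  using assms
  by (induction A)
    (simp_all add: var_prod_def indicator_exp_def var_def monomial_def mult_single)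

lemma lookup_times_monomial:
  "Poly_Mapping.lookup (p * monomial b :: 'k::field mpoly) (a + b) = Poly_Mapping.lookup p a"
proof -
  have "(\<Sum>q. Poly_Mapping.lookup (monomial b :: 'k mpoly) q when a + b = l + q) = (1 when l = a)"
    for l
  proof -
    have "(\<lambda>q. Poly_Mapping.lookup (monomial b :: 'k mpoly) q when a + b = l + q) =
        (\<lambda>q. (1 when l = a) when q = b)"
      by (auto simp: monomial_def lookup_single when_def fun_eq_iff)
    then show ?thesis by (simp only: Sum_any_when_equal)
  qed
  then show ?thesis by (simp add: lookup_mult mult_when)
qed

lemma monomial_inj: "(monomial a :: 'k::field mpoly) = monomial b \<longleftrightarrow> a = b"
  by (metis keys_single monomial_def singleton_inject zero_neq_one)

lemma var_prod_inj:
  assumes "finite A" "finite B"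
  shows "(var_prod A :: 'k::field mpoly) = var_prod B \<longleftrightarrow> A = B"
  using assms keys_indicator_exp by (metis monomial_inj var_prod_eq_monomial)

lemma keys_add_nat:
  "Poly_Mapping.keys (a + b :: nat \<Rightarrow>\<^sub>0 nat) = Poly_Mapping.keys a \<union> Poly_Mapping.keys b"
  by (auto simp: in_keys_iff lookup_add)

lemma indicator_exp_dvd:
  assumes "finite B" "B \<subseteq> Poly_Mapping.keys a"
  shows "a - indicator_exp B + indicator_exp B = a"
  using assms
  by (intro poly_mapping_eqI) (auto simp: lookup_add lookup_minus lookup_indicator_exp in_keys_iff)

text \<open>
  The polynomials described on the right form an ideal because the support of a product of
  monomials is the union of the supports; conversely each term of such a polynomial is a multiple
  of a generator. Only supports matter, since the generators are squarefree.
\<close>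

lemma mem_squarefree_monomial_ideal:
  fixes p :: "'k::field mpoly"
  assumes sets: "\<B> \<subseteq> Pow {1..n}"
  shows "p \<in> Idl\<^bsub>poly_ring n\<^esub> (var_prod ` \<B>) \<longleftrightarrow>
    p \<in> carrier (poly_ring n) \<and> (\<forall>a \<in> Poly_Mapping.keys p. \<exists>B \<in> \<B>. B \<subseteq> Poly_Mapping.keys a)"
    (is "p \<in> ?I \<longleftrightarrow> _")
proof -
  interpret cring "poly_ring n :: 'k mpoly ring" by (rule cring_poly_ring)
  have fin: "finite B" if "B \<in> \<B>" for B using sets that finite_subset by blast
  define J :: "'k mpoly set" where "J = {p. p \<in> carrier (poly_ring n) \<and>
    (\<forall>a \<in> Poly_Mapping.keys p. \<exists>B \<in> \<B>. B \<subseteq> Poly_Mapping.keys a)}"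
  have gens: "(var_prod ` \<B> :: 'k mpoly set) \<subseteq> carrier (poly_ring n)"
    using sets var_prod_carrier by blast
  have I: "ideal ?I (poly_ring n)" using gens by (rule genideal_ideal)
  have absorb: "q * p \<in> J" if "q \<in> carrier (poly_ring n)" "p \<in> J" for p q
  proof -
    have "\<exists>B \<in> \<B>. B \<subseteq> Poly_Mapping.keys c" if c: "c \<in> Poly_Mapping.keys (q * p)" for c
    proof -
      have "c \<in> {a + b | a b. a \<in> Poly_Mapping.keys q \<and> b \<in> Poly_Mapping.keys p}"
        using Poly_Mapping.keys_mult c by (rule subsetD)
      then obtain a b where "c = a + b" "b \<in> Poly_Mapping.keys p"
        by blast
      moreover from this obtain B where "B \<in> \<B>" "B \<subseteq> Poly_Mapping.keys b"
        using \<open>p \<in> J\<close> unfolding J_def by blast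
      ultimately show ?thesis by (auto simp: keys_add_nat)
    qed
    then show ?thesis using that poly_ring_mult_closed unfolding J_def by blast
  qed
  then have absorb': "p * q \<in> J" if "q \<in> carrier (poly_ring n)" "p \<in> J" for p q
    using that by (subst mult.commute)
  have add: "p + q \<in> J" if "p \<in> J" "q \<in> J" for p q
    using that poly_ring_add_closed Poly_Mapping.keys_add[of p q] unfolding J_def by blast
  have "subgroup J (add_monoid (poly_ring n))"
  proof (rule add.subgroupI)
    show "J \<subseteq> carrier (poly_ring n)" unfolding J_def by blast
    have "0 \<in> J" unfolding J_def by (simp add: carrier_poly_ring)
    then show "J \<noteq> {}" by blast
    show "p \<oplus>\<^bsub>poly_ring n\<^esub> q \<in> J" if "p \<in> J" "q \<in> J" for p q using that add by simp
    fix p assume p: "p \<in> J"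
    then have "\<ominus>\<^bsub>poly_ring n\<^esub> \<one>\<^bsub>poly_ring n\<^esub> \<otimes>\<^bsub>poly_ring n\<^esub> p = \<ominus>\<^bsub>poly_ring n\<^esub> p"
      using l_minus[of "\<one>\<^bsub>poly_ring n\<^esub>" p] l_one[of p] one_closed unfolding J_def by simp
    then show "\<ominus>\<^bsub>poly_ring n\<^esub> p \<in> J" using absorb[OF _ p] one_closed a_inv_closed
      by (metis poly_ring_simps(1))
  qed
  then have "ideal J (poly_ring n)"
    using absorb absorb' ring_axioms by (intro idealI) simp_all
  moreover have "(var_prod ` \<B> :: 'k mpoly set) \<subseteq> J"
    using gens fin unfolding J_def
    by (auto simp: var_prod_eq_monomial monomial_def keys_indicator_exp)
  ultimately have IJ: "?I \<subseteq> J" by (rule genideal_minimal)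
  have monomial_mem: "Poly_Mapping.single a c \<in> ?I"
    if a: "Poly_Mapping.keys a \<subseteq> {1..n}" and B: "B \<in> \<B>" "B \<subseteq> Poly_Mapping.keys a" for a B c
  proof -
    have "Poly_Mapping.keys (a - indicator_exp B) \<subseteq> {1..n}"
      using a by (auto simp: in_keys_iff lookup_minus)
    then have "Poly_Mapping.single (a - indicator_exp B) c \<in> carrier (poly_ring n)"
      by (simp add: carrier_poly_ring)
    moreover have "var_prod B \<in> ?I" using genideal_self[OF gens] B(1) by blast
    ultimately have "Poly_Mapping.single (a - indicator_exp B) c * var_prod B \<in> ?I"
      using ideal.I_l_closed[OF I] by fastforce
    then show ?thesis using indicator_exp_dvd[OF fin[OF B(1)] B(2)]
      by (simp add: var_prod_eq_monomial[OF fin[OF B(1)]] monomial_def mult_single)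
  qed
  have "p \<in> ?I" if "p \<in> J" for p
  proof -
    have expansion: "p = (\<Sum>a \<in> Poly_Mapping.keys p. Poly_Mapping.single a (Poly_Mapping.lookup p a))"
      by (intro poly_mapping_eqI)
        (auto simp: lookup_sum lookup_single when_def in_keys_iff)
    have "(\<Sum>a \<in> A. Poly_Mapping.single a (Poly_Mapping.lookup p a)) \<in> ?I"
      if "finite A" "A \<subseteq> Poly_Mapping.keys p" for A
      using that
    proof (induction A)
      case empty
      then show ?case using additive_subgroup.zero_closed[OF ideal.axioms(1)[OF I]] by simp
    next
      case (insert a A)
      then obtain B where "B \<in> \<B>" "B \<subseteq> Poly_Mapping.keys a" "Poly_Mapping.keys a \<subseteq> {1..n}"
        using \<open>p \<in> J\<close> unfolding J_def carrier_poly_ring by blast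
      then show ?case using insert monomial_mem[of a B "Poly_Mapping.lookup p a"]
        additive_subgroup.a_closed[OF ideal.axioms(1)[OF I]] by fastforce
    qed
    from this[of "Poly_Mapping.keys p"] show ?thesis using expansion by simp
  qed
  with IJ have "?I = J" by blast
  then show ?thesis unfolding J_def by simp
qed

lemma var_prod_mem_ideal:
  assumes "A \<subseteq> {1..n}" "\<B> \<subseteq> Pow {1..n}"
  shows "(var_prod A :: 'k::field mpoly) \<in> Idl\<^bsub>poly_ring n\<^esub> (var_prod ` \<B>) \<longleftrightarrow> (\<exists>B \<in> \<B>. B \<subseteq> A)"
proof -
  have "finite A" using assms(1) finite_subset by blast
  then have "Poly_Mapping.keys (var_prod A :: 'k mpoly) = {indicator_exp A}"
    by (simp add: var_prod_eq_monomial monomial_def)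
  then show ?thesis
    unfolding mem_squarefree_monomial_ideal[OF assms(2)] using assms(1) \<open>finite A\<close>
    by (simp add: var_prod_carrier keys_indicator_exp)
qed

lemma var_times_mem_ideal:
  assumes "A \<subseteq> {1..n}" "s \<in> {1..n}" "\<B> \<subseteq> Pow {1..n}"
  shows "(var s * var_prod A :: 'k::field mpoly) \<in> Idl\<^bsub>poly_ring n\<^esub> (var_prod ` \<B>) \<longleftrightarrow>
    (\<exists>B \<in> \<B>. B \<subseteq> insert s A)"
proof -
  have "finite A" using assms(1) finite_subset by blast
  then have "Poly_Mapping.keys (var s * var_prod A :: 'k mpoly) =
      {Poly_Mapping.single s 1 + indicator_exp A}"
    by (simp add: var_prod_eq_monomial var_def monomial_def mult_single)
  moreover have "(var s * var_prod A :: 'k mpoly) \<in> carrier (poly_ring n)"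
    using assms by (intro poly_ring_mult_closed var_carrier var_prod_carrier)
  ultimately show ?thesis
    unfolding mem_squarefree_monomial_ideal[OF assms(3)] using \<open>finite A\<close>
    by (simp add: keys_add_nat keys_indicator_exp)
qed

lemma squarefree_ideal_mono:
  assumes "\<B> \<subseteq> Pow {1..n}" "\<C> \<subseteq> Pow {1..n}"
    and "\<And>B. B \<in> \<B> \<Longrightarrow> \<exists>C \<in> \<C>. C \<subseteq> B"
  shows "(Idl\<^bsub>poly_ring n\<^esub> (var_prod ` \<B>) :: 'k::field mpoly set) \<subseteq> Idl\<^bsub>poly_ring n\<^esub> (var_prod ` \<C>)"
proof
  fix p :: "'k mpoly" assume "p \<in> Idl\<^bsub>poly_ring n\<^esub> (var_prod ` \<B>)"
  then show "p \<in> Idl\<^bsub>poly_ring n\<^esub> (var_prod ` \<C>)"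
    unfolding mem_squarefree_monomial_ideal[OF assms(1)] mem_squarefree_monomial_ideal[OF assms(2)]
    using assms(3) by (meson subset_trans)
qed

section \<open>Monomial complete intersections\<close>

text \<open>
  If \<open>g x\<^sub>F\<close> lies in the ideal of the earlier monomials, then every term of \<open>g\<close> times \<open>x\<^sub>F\<close> is
  divisible by one of them, and this one has no variable in common with \<open>x\<^sub>F\<close>, so it already
  divides the term of \<open>g\<close>.
\<close>

lemma regular_sequence_disjoint_supports:
  assumes sets: "\<And>F. F \<in> set Fs \<Longrightarrow> F \<subseteq> {1..n} \<and> F \<noteq> {}"
    and disjoint: "\<And>i j. i < j \<Longrightarrow> j < length Fs \<Longrightarrow> Fs ! i \<inter> Fs ! j = {}"
  shows "regular_sequence (poly_ring n) (map var_prod Fs :: 'k::field mpoly list)"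
  unfolding regular_sequence_def
proof (intro conjI allI impI ballI)
  show "set (map var_prod Fs :: 'k mpoly list) \<subseteq> carrier (poly_ring n)"
    unfolding set_map using sets by (blast intro: var_prod_carrier)
  have take: "set (take i Fs) \<subseteq> Pow {1..n}" for i
    using sets by (blast dest: in_set_takeD)
  show "g \<in> Idl\<^bsub>poly_ring n\<^esub> (set (take i (map var_prod Fs)))"
    if i: "i < length (map var_prod Fs :: 'k mpoly list)" and g: "g \<in> carrier (poly_ring n)"
      and mem: "g \<otimes>\<^bsub>poly_ring n\<^esub> map var_prod Fs ! i \<in> Idl\<^bsub>poly_ring n\<^esub> (set (take i (map var_prod Fs)))"
    for i and g :: "'k mpoly"
  proof -
    have eq: "set (take i (map var_prod Fs :: 'k mpoly list)) = var_prod ` set (take i Fs)"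
      by (simp add: take_map)
    let ?F = "Fs ! i"
    have fin: "finite ?F" using sets[of ?F] i finite_subset by fastforce
    have "\<exists>B \<in> set (take i Fs). B \<subseteq> Poly_Mapping.keys a" if a: "a \<in> Poly_Mapping.keys g" for a
    proof -
      have "Poly_Mapping.lookup (g * var_prod ?F) (a + indicator_exp ?F) = Poly_Mapping.lookup g a"
        unfolding var_prod_eq_monomial[OF fin] by (rule lookup_times_monomial)
      then have "a + indicator_exp ?F \<in> Poly_Mapping.keys (g * var_prod ?F)"
        using a by (simp add: in_keys_iff)
      then obtain B where B: "B \<in> set (take i Fs)" "B \<subseteq> Poly_Mapping.keys (a + indicator_exp ?F)"
        using mem i unfolding eq mem_squarefree_monomial_ideal[OF take] by auto
      then have "B \<subseteq> Poly_Mapping.keys a \<union> ?F" using fin by (simp add: keys_add_nat keys_indicator_exp)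
      moreover obtain j where "j < i" "B = Fs ! j" using B(1) i by (auto simp: in_set_conv_nth)
      then have "B \<inter> ?F = {}" using disjoint[of j i] i by simp
      ultimately show ?thesis using B(1) by blast
    qed
    then show ?thesis unfolding eq mem_squarefree_monomial_ideal[OF take] using g by blast
  qed
  have "(1 :: 'k mpoly) = var_prod {}" by (simp add: var_prod_def)
  then have "(1 :: 'k mpoly) \<notin> Idl\<^bsub>poly_ring n\<^esub> (var_prod ` set Fs)"
    using var_prod_mem_ideal[of "{}" n "set Fs", where 'k = 'k] sets by auto
  then show "Idl\<^bsub>poly_ring n\<^esub> (set (map var_prod Fs)) \<noteq> (carrier (poly_ring n) :: 'k mpoly set)"
    using one_poly_ring by auto
qed

lemma complete_intersection_disjoint_nonfaces:
  assumes sets: "\<And>F. F \<in> \<F> \<Longrightarrow> F \<subseteq> {1..n} \<and> F \<noteq> {}"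
    and disjoint: "\<And>E F. E \<in> \<F> \<Longrightarrow> F \<in> \<F> \<Longrightarrow> E \<noteq> F \<Longrightarrow> E \<inter> F = {}"
    and nonfaces: "\<And>F. F \<subseteq> {1..n} \<Longrightarrow> F \<notin> \<Delta> \<longleftrightarrow> (\<exists>E \<in> \<F>. E \<subseteq> F)"
  shows "stanley_reisner_complete_intersection TYPE('k::field) n \<Delta>"
proof -
  have "\<F> \<subseteq> Pow {1..n}" using sets by blast
  then have "finite \<F>" by (rule finite_subset) simp
  then obtain Fs where Fs: "set Fs = \<F>" "distinct Fs" using finite_distinct_list by blast
  have "Fs ! i \<inter> Fs ! j = {}" if "i < j" "j < length Fs" for i j
  proof (rule disjoint)
    show "Fs ! i \<in> \<F>" "Fs ! j \<in> \<F>" using that Fs(1) nth_mem[of i Fs] nth_mem[of j Fs] by auto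
    show "Fs ! i \<noteq> Fs ! j" using that Fs(2) by (simp add: nth_eq_iff_index_eq)
  qed
  then have reg: "regular_sequence (poly_ring n) (map var_prod Fs :: 'k mpoly list)"
    using sets Fs by (intro regular_sequence_disjoint_supports) auto
  have eq: "{var_prod F :: 'k mpoly | F. F \<subseteq> {1..n} \<and> F \<notin> \<Delta>} =
      var_prod ` {F. F \<subseteq> {1..n} \<and> F \<notin> \<Delta>}" by blast
  have "(Idl\<^bsub>poly_ring n\<^esub> (var_prod ` \<F>) :: 'k mpoly set) = stanley_reisner_ideal n \<Delta>"
    unfolding stanley_reisner_ideal_def eq
  proof (rule subset_antisym; rule squarefree_ideal_mono)
    show "\<exists>F \<in> {F. F \<subseteq> {1..n} \<and> F \<notin> \<Delta>}. F \<subseteq> E" if "E \<in> \<F>" for E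
      using that sets[OF that] nonfaces[of E] by blast
    show "\<exists>E \<in> \<F>. E \<subseteq> F" if "F \<in> {F. F \<subseteq> {1..n} \<and> F \<notin> \<Delta>}" for F
      using that nonfaces[of F] by blast
  qed (use sets in blast)+
  with reg Fs(1) show ?thesis
    unfolding stanley_reisner_complete_intersection_def complete_intersection_quotient_def
    by (intro exI[of _ "map var_prod Fs"]) simp
qed

section \<open>Minimal generators and linear quotients\<close>

text \<open>
  Each family refines the other: a member of \<open>\<P>\<close> contains one of \<open>\<R>\<close>, which contains one of
  \<open>\<P>\<close>. By irredundancy of the generators the first and the last agree.
\<close>

lemma minimal_generators_antichain:
  fixes \<P> \<R> :: "nat set set"
  assumes P: "\<P> \<subseteq> Pow {1..n}" and R: "\<R> \<subseteq> Pow {1..n}"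
    and antichain: "\<And>A B. A \<in> \<R> \<Longrightarrow> B \<in> \<R> \<Longrightarrow> A \<subseteq> B \<Longrightarrow> A = B"
    and min: "min_monomial_gens n (Idl\<^bsub>poly_ring n\<^esub> (var_prod ` \<R>))
      (var_prod ` \<P> :: 'k::field mpoly set)"
  shows "\<P> = \<R>"
proof -
  have eq: "(Idl\<^bsub>poly_ring n\<^esub> (var_prod ` \<P>) :: 'k mpoly set) = Idl\<^bsub>poly_ring n\<^esub> (var_prod ` \<R>)"
    and irredundant: "\<And>H. H \<subset> (var_prod ` \<P> :: 'k mpoly set) \<Longrightarrow>
      Idl\<^bsub>poly_ring n\<^esub> H \<noteq> Idl\<^bsub>poly_ring n\<^esub> (var_prod ` \<P>)"
    using min unfolding min_monomial_gens_def by auto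
  have mem: "(\<exists>B \<in> \<P>. B \<subseteq> A) \<longleftrightarrow> (\<exists>B \<in> \<R>. B \<subseteq> A)" if "A \<subseteq> {1..n}" for A
    using eq var_prod_mem_ideal[OF that P, where 'k = 'k] var_prod_mem_ideal[OF that R, where 'k = 'k]
    by blast
  have PR: "A \<in> \<R>" if A: "A \<in> \<P>" for A
  proof -
    obtain B where B: "B \<in> \<R>" "B \<subseteq> A" using mem[of A] A P by blast
    then obtain C where C: "C \<in> \<P>" "C \<subseteq> B" using mem[of B] R by blast
    have "C = A"
    proof (rule ccontr)
      assume "C \<noteq> A"
      have "finite X" if "X \<in> \<P>" for X using that P finite_subset by blast
      then have "inj_on (var_prod :: nat set \<Rightarrow> 'k mpoly) \<P>"
        by (intro inj_onI) (simp add: var_prod_inj)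
      then have "(var_prod A :: 'k mpoly) \<notin> var_prod ` (\<P> - {A})"
        using A inj_on_image_mem_iff[of "var_prod :: nat set \<Rightarrow> 'k mpoly" \<P> A "\<P> - {A}"] by simp
      then have "var_prod ` (\<P> - {A}) \<subset> (var_prod ` \<P> :: 'k mpoly set)"
        using A by blast
      moreover have "(Idl\<^bsub>poly_ring n\<^esub> (var_prod ` (\<P> - {A})) :: 'k mpoly set) =
          Idl\<^bsub>poly_ring n\<^esub> (var_prod ` \<P>)"
      proof (rule subset_antisym; rule squarefree_ideal_mono)
        show "\<exists>D \<in> \<P> - {A}. D \<subseteq> X" if "X \<in> \<P>" for X
          using that B C \<open>C \<noteq> A\<close> by (cases "X = A") blast+
        show "\<exists>D \<in> \<P>. D \<subseteq> X" if "X \<in> \<P> - {A}" for X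
          using that by blast
      qed (use P in blast)+
      ultimately show False using irredundant[of "var_prod ` (\<P> - {A})"] by simp
    qed
    with B C show ?thesis by (metis subset_antisym)
  qed
  moreover have "A \<in> \<P>" if "A \<in> \<R>" for A
    using mem[of A] PR antichain[of _ A] that R by blast
  ultimately show ?thesis by blast
qed

lemma lex_gt_var_prod:
  assumes "finite A" "finite B" "lex_gt (var_prod A :: 'k::field mpoly) (var_prod B)"
  obtains k where "k \<in> A" "k \<notin> B" "\<And>j. j < k \<Longrightarrow> j \<in> A \<longleftrightarrow> j \<in> B"
proof -
  have "indicator_exp B < indicator_exp A"
    using assms unfolding lex_gt_def by (auto simp: var_prod_eq_monomial monomial_inj)
  then obtain k where k: "Poly_Mapping.lookup (indicator_exp B) k < Poly_Mapping.lookup (indicator_exp A) k"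
    "\<forall>j < k. Poly_Mapping.lookup (indicator_exp B) j = Poly_Mapping.lookup (indicator_exp A) j"
    unfolding exponent_less_iff by blast
  show thesis
  proof (rule that)
    show "k \<in> A" "k \<notin> B" using k(1) assms by (auto simp: lookup_indicator_exp split: if_splits)
    show "j \<in> A \<longleftrightarrow> j \<in> B" if "j < k" for j
      using k(2) that assms by (auto simp: lookup_indicator_exp split: if_splits)
  qed
qed

text \<open>
  The first position at which \<open>A\<close> and \<open>R\<close> differ lies in \<open>A\<close>, so it is \<open>s\<close>; the single position
  of \<open>R\<close> that is missing from \<open>A\<close> comes later.
\<close>

lemma lex_greater_neighbour:
  fixes A R :: "nat set"
  assumes fin: "finite A" "finite R" and "card A = card R"
    and lex: "lex_gt (var_prod A :: 'k::field mpoly) (var_prod R)" and sub: "A \<subseteq> insert s R"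
  shows "s \<notin> R \<and> (\<exists>t \<in> R. s < t \<and> A = insert s (R - {t}))"
proof -
  obtain k where k: "k \<in> A" "k \<notin> R" "\<And>j. j < k \<Longrightarrow> j \<in> A \<longleftrightarrow> j \<in> R"
    using lex_gt_var_prod[OF fin lex] by blast
  then have s: "k = s" using sub by blast
  have "A \<inter> R = A - {s}" using k s sub by blast
  then have "card (R - A) = 1"
    using k s fin \<open>card A = card R\<close> card_gt_0_iff[of A]
    by (auto simp: card_Diff_subset_Int Int_commute)
  then obtain t where t: "R - A = {t}" by (rule card_1_singletonE)
  have "A = insert s (R - {t})" using t k s sub by blast
  moreover have "s < t" using t k(3)[of t] k(1) s by (metis Diff_iff linorder_neqE_nat singletonI)
  ultimately show ?thesis using t k s by blast
qed

text \<open>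
  A set that misses \<open>R - t\<close> can meet \<open>R\<close> only in \<open>t\<close>, and \<open>R - t + s\<close> only in \<open>s\<close>. So the minimal
  nonfaces are the points of \<open>R - t\<close> and the set \<open>D + t\<close>, which are pairwise disjoint.
\<close>

lemma complete_intersection_star:
  assumes R: "R \<subseteq> {1..n}" and D: "D \<subseteq> {1..n}" "D \<inter> R = {}"
    and t: "t \<in> R"
    and nonfaces: "\<And>F. F \<subseteq> {1..n} \<Longrightarrow> F \<notin> \<Delta> \<longleftrightarrow>
      F \<inter> R \<noteq> {} \<and> (\<forall>s \<in> D. F \<inter> insert s (R - {t}) \<noteq> {})"
  shows "stanley_reisner_complete_intersection TYPE('k::field) n \<Delta>"
proof (rule complete_intersection_disjoint_nonfaces)
  let ?\<F> = "insert (insert t D) ((\<lambda>j. {j}) ` (R - {t}))"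
  show "F \<subseteq> {1..n} \<and> F \<noteq> {}" if "F \<in> ?\<F>" for F using that R D t by blast
  show "E \<inter> F = {}" if "E \<in> ?\<F>" "F \<in> ?\<F>" "E \<noteq> F" for E F using that D t by auto
  show "F \<notin> \<Delta> \<longleftrightarrow> (\<exists>E \<in> ?\<F>. E \<subseteq> F)" if "F \<subseteq> {1..n}" for F
    unfolding nonfaces[OF that] using t by auto
qed

lemma nonface_subword_complex_iff:
  assumes "F \<subseteq> {1..length Q}"
  shows "F \<notin> subword_complex W S Q w \<longleftrightarrow>
    (\<forall>B \<subseteq> {1..length Q}. represents W S Q B w \<longrightarrow> F \<inter> B \<noteq> {})"
proof -
  have "F \<in> subword_complex W S Q w \<longleftrightarrow> subword_contains W S Q ({1..length Q} - F) w"
  proof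
    assume "F \<in> subword_complex W S Q w"
    then obtain P where "F = {1..length Q} - P" "P \<subseteq> {1..length Q}" "subword_contains W S Q P w"
      unfolding subword_complex_def by blast
    moreover from this have "{1..length Q} - F = P" by blast
    ultimately show "subword_contains W S Q ({1..length Q} - F) w" by simp
  next
    assume "subword_contains W S Q ({1..length Q} - F) w"
    moreover have "F = {1..length Q} - ({1..length Q} - F)" using assms by blast
    ultimately show "F \<in> subword_complex W S Q w" unfolding subword_complex_def by blast
  qed
  then show ?thesis unfolding subword_contains_def by blast
qed

theorem proposition2p9:
  fixes W :: "('w, 'b) monoid_scheme" and S :: "'w set" and Q :: "'w list" and \<pi> :: 'w
    and n r :: nat and \<Delta> :: "nat set set" and P :: "nat \<Rightarrow> nat set"
    and us :: "'k::field mpoly list"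
  assumes "coxeter_system W S"
    and "Q \<in> lists S" and "length Q = n" and "\<pi> \<in> carrier W"
    and "\<Delta> = subword_complex W S Q \<pi>"
    and "\<And>i. i \<in> {1..r} \<Longrightarrow> P i \<subseteq> {1..n}"
    and "us = map (\<lambda>i. var_prod (P i)) [1..<r + 1]"
    and "min_monomial_gens n (stanley_reisner_ideal n (alexander_dual n \<Delta>)) (set us)"
    and "sorted_wrt lex_gt us"
    and "int r \<le> int n - int (cox_length W S \<pi>) + 1"
    and "int (card (lq_set n us r)) = int r - 1"
  shows "stanley_reisner_complete_intersection TYPE('k) n \<Delta>"
proof -
  interpret coxeter_word W S Q
    using assms(1,2) by unfold_locales
  note n = assms(3) and us = assms(7)
  define \<R> where "\<R> = {A. A \<subseteq> {1..n} \<and> represents W S Q A \<pi>}"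
  have R_sub: "\<R> \<subseteq> Pow {1..n}" unfolding \<R>_def by blast
  then have R_fin: "finite A" if "A \<in> \<R>" for A using that finite_subset by blast
  have R_card: "card A = cox_length W S \<pi>" if "A \<in> \<R>" for A
    using that represents_iff n unfolding \<R>_def by blast
  have "{var_prod A :: 'k mpoly | A. A \<subseteq> {1..n} \<and> represents W S Q A \<pi>} = var_prod ` \<R>"
    unfolding \<R>_def by blast
  then have ideal_eq: "(stanley_reisner_ideal n (alexander_dual n \<Delta>) :: 'k mpoly set) =
      Idl\<^bsub>poly_ring n\<^esub> (var_prod ` \<R>)"
    using stanley_reisner_ideal_dual_subword_complex[of Q W S \<pi>, where 'k = 'k] n assms(5) by simp
  have set_us: "set us = var_prod ` P ` {1..r}" unfolding us
    by (simp add: image_image atLeastLessThanSuc_atLeastAtMost del: upt_Suc)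
  have PR: "P ` {1..r} = \<R>"
  proof (rule minimal_generators_antichain[where 'k = 'k])
    show "P ` {1..r} \<subseteq> Pow {1..n}" using assms(6) by blast
    show "A = B" if "A \<in> \<R>" "B \<in> \<R>" "A \<subseteq> B" for A B
      using that R_card R_fin by (metis card_subset_eq)
    show "min_monomial_gens n (Idl\<^bsub>poly_ring n\<^esub> (var_prod ` \<R>))
        (var_prod ` P ` {1..r} :: 'k mpoly set)"
      using assms(8) unfolding ideal_eq set_us .
  qed (rule R_sub)

  have "r \<ge> 1" using assms(11) by linarith
  define R where "R = P r"
  define D where "D = lq_set n us r"
  have R: "R \<in> \<R>" unfolding PR[symmetric] R_def using \<open>r \<ge> 1\<close> by auto
  have cardD: "card D = r - 1" using assms(11) unfolding D_def by linarith
  have lex: "lex_gt (var_prod (P i) :: 'k mpoly) (var_prod R)" if "i \<in> {1..<r}" for i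
    using sorted_wrt_nth_less[OF assms(9), of "i - 1" "r - 1"] that \<open>r \<ge> 1\<close>
    unfolding us R_def by (simp add: diff_less_mono del: upt_Suc)
  have step: "s \<in> {1..n} \<and> s \<notin> R \<and> (\<exists>t \<in> R. s < t \<and> (\<exists>i \<in> {1..<r}. P i = insert s (R - {t})))"
    if s: "s \<in> D" for s
  proof -
    have "r \<noteq> 1" using s unfolding D_def lq_set_def by auto
    have "set (take (r - 1) us) = var_prod ` P ` {1..<r}"
      unfolding us
      using \<open>r \<ge> 1\<close> by (simp add: take_map take_upt image_image del: upt_Suc)
    moreover have "us ! (r - 1) = var_prod R"
      unfolding us R_def using \<open>r \<ge> 1\<close> by (simp del: upt_Suc)
    ultimately have "s \<in> {1..n}" "var s * var_prod R \<in>
        (Idl\<^bsub>poly_ring n\<^esub> (var_prod ` P ` {1..<r}) :: 'k mpoly set)"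
      using s \<open>r \<noteq> 1\<close> unfolding D_def lq_set_def colon_ideal_def by auto
    moreover have "P ` {1..<r} \<subseteq> Pow {1..n}" using assms(6) by fastforce
    moreover have "R \<subseteq> {1..n}" using R R_sub by blast
    ultimately have "\<exists>B \<in> P ` {1..<r}. B \<subseteq> insert s R"
      using var_times_mem_ideal[of R n s "P ` {1..<r}", where 'k = 'k] by blast
    then obtain i where i: "i \<in> {1..<r}" "P i \<subseteq> insert s R" by blast
    then have "P i \<in> \<R>" unfolding PR[symmetric] by auto
    then show ?thesis
      using lex_greater_neighbour[OF _ _ _ lex[OF i(1)] i(2)] R R_fin R_card i(1) \<open>s \<in> {1..n}\<close>
      by metis
  qed
  then obtain t f where tf: "\<And>s. s \<in> D \<Longrightarrow> t s \<in> R \<and> s < t s \<and> f s \<in> {1..<r} \<and>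
      P (f s) = insert s (R - {t s})"
    by metis
  \<comment> \<open>There are \<open>r - 1\<close> elements of \<open>D\<close>, and each determines a different predecessor of \<open>R\<close>, so
    every predecessor arises in this way.\<close>
  have "inj_on f D"
  proof (rule inj_onI)
    fix s s' assume ss: "s \<in> D" "s' \<in> D" "f s = f s'"
    then have "insert s (R - {t s}) = insert s' (R - {t s'})" using tf by metis
    then show "s = s'" using step ss by blast
  qed
  then have "f ` D = {1..<r}"
    using tf cardD by (intro card_subset_eq) (auto simp: card_image)
  then have cases: "B = R \<or> (\<exists>s \<in> D. B = insert s (R - {t s}))" if B: "B \<in> \<R>" for B
  proof -
    obtain i where i: "i \<in> {1..r}" "B = P i" using B unfolding PR[symmetric] by blast
    show ?thesis
    proof (cases "i = r")
      case False
      then have "i \<in> f ` D" using i \<open>f ` D = {1..<r}\<close> by auto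
      then show ?thesis using i tf by blast
    qed (use i R_def in simp)
  qed
  have rep: "insert s (R - {t s}) \<in> \<R>" if "s \<in> D" for s
    using tf[OF that] unfolding PR[symmetric]
    by (metis atLeastAtMost_iff atLeastLessThan_iff image_eqI less_imp_le)
  have no_swap: "t s1 = t s2" if s: "s1 \<in> D" "s2 \<in> D" "s1 < s2" for s1 s2
  proof (rule ccontr)
    assume "t s1 \<noteq> t s2"
    have sub: "R \<subseteq> {1..length Q}" "represents W S Q R \<pi>"
      "represents W S Q (insert s1 (R - {t s1})) \<pi>" "represents W S Q (insert s2 (R - {t s2})) \<pi>"
      using R rep[OF s(1)] rep[OF s(2)] n unfolding \<R>_def by blast+
    have pos: "s1 \<in> {1..length Q}" "s2 \<in> {1..length Q}" "s1 \<notin> R" "s2 \<notin> R" "t s1 \<in> R" "t s2 \<in> R"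
      "s2 < t s2"
      using step[OF s(1)] step[OF s(2)] tf[OF s(1)] tf[OF s(2)] unfolding n by blast+
    obtain P' where P': "P' \<subseteq> {1..length Q}" "represents W S Q P' \<pi>" "s1 \<in> P'" "s2 \<in> P'"
      using double_exchange[OF sub(1,2) pos(1-6) s(3) pos(7) \<open>t s1 \<noteq> t s2\<close> sub(3,4)] by blast
    then have "P' \<in> \<R>" unfolding \<R>_def n by blast
    then show False using cases[of P'] P'(3,4) step[OF s(1)] step[OF s(2)] s(3) by blast
  qed
  have t_const: "t s1 = t s2" if "s1 \<in> D" "s2 \<in> D" for s1 s2
    using no_swap[of s1 s2] no_swap[of s2 s1] that by (metis linorder_neqE_nat)
  have nonfaces: "F \<notin> \<Delta> \<longleftrightarrow> F \<inter> R \<noteq> {} \<and> (\<forall>s \<in> D. F \<inter> insert s (R - {t s}) \<noteq> {})"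
    if "F \<subseteq> {1..n}" for F
  proof -
    have "F \<notin> \<Delta> \<longleftrightarrow> (\<forall>B \<subseteq> {1..n}. represents W S Q B \<pi> \<longrightarrow> F \<inter> B \<noteq> {})"
      using nonface_subword_complex_iff[of F Q W S \<pi>] that unfolding n assms(5) by simp
    also have "\<dots> \<longleftrightarrow> (\<forall>B \<in> \<R>. F \<inter> B \<noteq> {})" unfolding \<R>_def by blast
    also have "\<R> = insert R ((\<lambda>s. insert s (R - {t s})) ` D)"
    proof (intro subset_antisym subsetI)
      show "B \<in> insert R ((\<lambda>s. insert s (R - {t s})) ` D)" if "B \<in> \<R>" for B
        using cases[OF that] by (elim disjE bexE) simp_all
      show "B \<in> \<R>" if "B \<in> insert R ((\<lambda>s. insert s (R - {t s})) ` D)" for B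
        using that R rep by (elim insertE imageE) simp_all
    qed
    finally show ?thesis by simp
  qed
  show ?thesis
  proof (cases "R = {}")
    \<comment> \<open>Here \<open>\<pi> = 1\<close>, and \<open>\<Delta>\<close> is the full simplex.\<close>
    case True
    show ?thesis
      by (rule complete_intersection_disjoint_nonfaces[of "{}"])
        (use nonfaces[unfolded True] in simp_all)
  next
    case False
    \<comment> \<open>If \<open>D\<close> is empty, that is \<open>r = 1\<close>, any position of \<open>R\<close> serves as the common \<open>t\<close>.\<close>
    obtain t0 where t0: "t0 \<in> R" "\<And>s. s \<in> D \<Longrightarrow> t s = t0"
    proof (cases "D = {}")
      case True
      then show thesis using that \<open>R \<noteq> {}\<close> by (metis all_not_in_conv empty_iff)
    next
      case False
      then obtain s0 where "s0 \<in> D" by auto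
      then show thesis using that[of "t s0"] tf[of s0] t_const[of _ s0] by metis
    qed
    show ?thesis
    proof (rule complete_intersection_star[of R n D t0])
      show "R \<subseteq> {1..n}" using R R_sub by blast
      show "D \<subseteq> {1..n}" "D \<inter> R = {}" using step by blast+
      show "F \<notin> \<Delta> \<longleftrightarrow> F \<inter> R \<noteq> {} \<and> (\<forall>s \<in> D. F \<inter> insert s (R - {t0}) \<noteq> {})"
        if "F \<subseteq> {1..n}" for F
        using nonfaces[OF that] t0(2) by auto
    qed (rule t0)
  qed
qed

end
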